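(* Let $\mathfrak G\subset\mathbb C^{c\times c}$ be a matrix Lie group with Lie algebra $\mathfrak g\subset\mathbb C^{c\times c}$. Suppose the proto-Lagrangian $\mathcal L$ is $\mathfrak G$-invariant, i.e. for all $U\in\mathfrak G$, $P\in\mathbb C^{r\times c}$, $R\in\mathbb C^{Nr\times c}$ and $x\in\mathbb R^N$, $$\mathcal L(PU;U^\dagger P^\dagger;RU;U^\dagger R^\dagger;x)=\mathcal L(P;P^\dagger;R;R^\dagger;x).$$ For $\Psi\in C^\infty(\mathbb R^N;\mathbb C^{r\times c})$ and $A_\mu\in C^\infty(\mathbb R^N;\mathfrak g)$, $1\le\mu\le N$, define the statically gauge extended Lagrangian density $$\mathcal L_{\Psi,A}(x)=\mathcal L\big(\Psi;\Psi^\dagger;\mathrm{col}[\partial_\mu\Psi+\Psi A_\mu]_{\mu};\mathrm{row}[\partial_\mu\Psi^\dagger+A_\mu^\dagger\Psi^\dagger]_{\mu};x\big),$$ all functions being evaluated at $x$. Then for all such $\Psi$, $A=(A_1,\dots,A_N)$, every $U\in C^\infty(\mathbb R^N;\mathfrak G)$ and all $x\in\mathbb R^N$, $$\mathcal L_{\Psi,A}(x)=\mathcal L_{\Psi U,\,A\triangleleft U}(x),$$ where $$\mathcal L_{\Psi U,A\triangleleft U}(x)=\mathcal L\big(\Psi U;U^\dagger\Psi^\dagger;\mathrm{col}[\partial_\mu(\Psi U)+(\Psi U)(A_\mu\triangleleft U)]_\mu;\mathrm{row}[\partial_\mu(\Psi U)^\dagger+(A_\mu\triangleleft U)^\dagger(\Psi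 U)^\dagger]_\mu;x\big).$$
   Context: $N,r,c$ are positive integers, $^\dagger$ is the conjugate transpose. A proto-Lagrangian is a function $\mathcal L:\mathbb C^{r\times c}\times\mathbb C^{c\times r}\times\mathbb C^{Nr\times c}\times\mathbb C^{c\times Nr}\times\mathbb R^N\to\mathbb C$, $(P;Q^\top;R;S^\top;x)\mapsto\mathcal L(P;Q^\top;R;S^\top;x)$, holomorphic in the matrix arguments and smooth, vanishing when all matrix arguments are $0$; $R=\mathrm{col}[R_1,\dots,R_N]$ with blocks $R_\mu\in\mathbb C^{r\times c}$ and $S^\top=\mathrm{row}[S_1^\top,\dots,S_N^\top]$ with blocks in $\mathbb C^{c\times r}$. $\mathfrak G$ consists of invertible $c\times c$ matrices. For $U\in C^\infty(\mathbb R^N;\mathfrak G)$, $(\Psi U)(x)=\Psi(x)U(x)$ and $(A_\mu\triangleleft U)(x)=U^{-1}(x)A_\mu(x)U(x)-U^{-1}(x)(\partial_\mu U)(x)$. *)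

theory Defs
  imports "HOL-Analysis.Analysis"
begin

text \<open>
  The positive integers N, r, c are the cardinalities of the finite index types
  \<open>'n\<close>, \<open>'r\<close>, \<open>'c\<close>. A matrix with \<open>'r\<close>-indexed rows and \<open>'c\<close>-indexed columns has type
  \<open>complex^'c^'r\<close>; the index type \<open>'n \<times> 'r\<close> (of cardinality N r) enumerates the rows of an
  N-fold column of blocks.
\<close>

fun C_k :: "nat \<Rightarrow> ('a::real_normed_vector \<Rightarrow> 'b::real_normed_vector) \<Rightarrow> bool" where
  "C_k 0 f \<longleftrightarrow> continuous_on UNIV f"
| "C_k (Suc k) f \<longleftrightarrow> (\<forall>x. f differentiable (at x)) \<and>
     (\<forall>v. C_k k (\<lambda>x. frechet_derivative f (at x) v))"

text \<open>
  All domains below are finite-dimensional, where continuity of all directional derivatives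
  \<open>\<lambda>x. frechet_derivative f (at x) v\<close> is the same as continuity of the derivative as a map into
  linear operators.
\<close>

definition smooth :: "('a::real_normed_vector \<Rightarrow> 'b::real_normed_vector) \<Rightarrow> bool" where
  "smooth f \<longleftrightarrow> (\<forall>k. C_k k f)"

definition pdiff :: "'n \<Rightarrow> (real^'n::finite \<Rightarrow> 'b::real_normed_vector) \<Rightarrow> real^'n \<Rightarrow> 'b" where
  "pdiff \<mu> f x = vector_derivative (\<lambda>t. f (x + t *\<^sub>R axis \<mu> 1)) (at 0)"

definition conj_transpose :: "complex^'n^'m \<Rightarrow> complex^'m^'n"
    ("(_\<^sup>\<dagger>)" [1000] 999) where
  "A\<^sup>\<dagger> = (\<chi> i j. cnj (A $ j $ i))"

definition col_blocks :: "('n \<Rightarrow> complex^'c^'r) \<Rightarrow> complex^'c^('n::finite \<times> 'r::finite)" where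
  "col_blocks B = (\<chi> p j. B (fst p) $ snd p $ j)"

definition row_blocks :: "('n \<Rightarrow> complex^'r^'c) \<Rightarrow> complex^('n::finite \<times> 'r::finite)^'c" where
  "row_blocks B = (\<chi> i p. B (fst p) $ i $ snd p)"

text \<open>
  Holomorphic in the four matrix arguments jointly: the Frechet derivative exists and is
  complex linear (\<open>mat a ** M\<close> is the scalar multiple of \<open>M\<close> by \<open>a\<close>).
\<close>

definition holomorphic_matrices ::
  "((complex^'c^'r) \<times> (complex^'r^'c) \<times> (complex^'c^'m) \<times> (complex^'m^'c) \<Rightarrow> complex) \<Rightarrow> bool"
  where
  "holomorphic_matrices F \<longleftrightarrow> (\<forall>p. \<exists>D. (F has_derivative D) (at p) \<and>
     (\<forall>a P Q R S. D (mat a ** P, mat a ** Q, mat a ** R, mat a ** S) = a * D (P, Q, R, S)))"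

definition proto_lagrangian ::
  "((complex^'c^'r) \<times> (complex^'r^'c) \<times> (complex^'c^('n::finite \<times> 'r::finite)) \<times>
    (complex^('n \<times> 'r)^'c) \<times> (real^'n) \<Rightarrow> complex) \<Rightarrow> bool" where
  "proto_lagrangian L \<longleftrightarrow>
     (\<forall>x. holomorphic_matrices (\<lambda>(P, Q, R, S). L (P, Q, R, S, x))) \<and>
     smooth L \<and>
     (\<forall>x. L (0, 0, 0, 0, x) = 0)"

text \<open>A matrix Lie group is a subgroup of the general linear group that is closed in it.\<close>

definition matrix_lie_group :: "(complex^'c^'c) set \<Rightarrow> bool" where
  "matrix_lie_group G \<longleftrightarrow>
     G \<subseteq> {A. invertible A} \<and>
     mat 1 \<in> G \<and> (\<forall>A\<in>G. \<forall>B\<in>G. A ** B \<in> G) \<and> (\<forall>A\<in>G. matrix_inv A \<in> G) \<and>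
     closedin (top_of_set {A. invertible A}) G"

text \<open>The Lie algebra as tangent space at the identity, i.e. velocities of smooth curves.\<close>

definition lie_algebra :: "(complex^'c^'c) set \<Rightarrow> (complex^'c^'c) set" where
  "lie_algebra G = {X. \<exists>\<gamma>::real \<Rightarrow> complex^'c^'c. smooth \<gamma> \<and> range \<gamma> \<subseteq> G \<and> \<gamma> 0 = mat 1 \<and>
     (\<gamma> has_vector_derivative X) (at 0)}"

definition gauge_extended ::
  "((complex^'c^'r) \<times> (complex^'r^'c) \<times> (complex^'c^('n::finite \<times> 'r::finite)) \<times>
    (complex^('n \<times> 'r)^'c) \<times> (real^'n) \<Rightarrow> complex) \<Rightarrow>
   (real^'n \<Rightarrow> complex^'c^'r) \<Rightarrow> ('n \<Rightarrow> real^'n \<Rightarrow> complex^'c^'c) \<Rightarrow> real^'n \<Rightarrow> complex" where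
  "gauge_extended L \<Psi> A x =
     L (\<Psi> x,
        (\<Psi> x)\<^sup>\<dagger>,
        col_blocks (\<lambda>\<mu>. pdiff \<mu> \<Psi> x + \<Psi> x ** A \<mu> x),
        row_blocks (\<lambda>\<mu>. pdiff \<mu> (\<lambda>y. (\<Psi> y)\<^sup>\<dagger>) x + (A \<mu> x)\<^sup>\<dagger> ** (\<Psi> x)\<^sup>\<dagger>),
        x)"

definition gauge_field :: "(real^'n \<Rightarrow> complex^'c^'r) \<Rightarrow> (real^'n \<Rightarrow> complex^'c^'c) \<Rightarrow>
    real^'n \<Rightarrow> complex^'c^'r" where
  "gauge_field \<Psi> U x = \<Psi> x ** U x"

definition gauge_potential ::
  "('n \<Rightarrow> real^'n \<Rightarrow> complex^'c^'c) \<Rightarrow> (real^'n::finite \<Rightarrow> complex^'c^'c) \<Rightarrow>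
   'n \<Rightarrow> real^'n \<Rightarrow> complex^'c^'c" (infixl "\<triangleleft>" 75) where
  "(A \<triangleleft> U) \<mu> x =
     matrix_inv (U x) ** A \<mu> x ** U x - matrix_inv (U x) ** pdiff \<mu> U x"

end

theory Submission
  imports Defs
begin

text \<open>
  The gauge transformation of the potential makes the covariant derivative equivariant:
  the inhomogeneous term \<open>- U\<^sup>-\<^sup>1 \<partial>\<^sub>\<mu> U\<close> cancels the term \<open>\<Psi> \<partial>\<^sub>\<mu> U\<close> of the product rule, so
  \<open>\<partial>\<^sub>\<mu> (\<Psi> U) + \<Psi> U (A\<^sub>\<mu> \<triangleleft> U) = (\<partial>\<^sub>\<mu> \<Psi> + \<Psi> A\<^sub>\<mu>) U\<close>. As \<open>\<dagger>\<close> is real linear and commutes with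
  \<open>\<partial>\<^sub>\<mu>\<close>, the row argument is the conjugate transpose of the column argument, and pointwise
  invariance of \<open>L\<close> at \<open>V = U x\<close> applies.
\<close>

text \<open>Conjugation of entries is antilinear over the complex numbers but linear over the reals,
  and in finite dimension real linearity gives boundedness. Derivatives in real parameters therefore
  pass through the conjugate transpose.\<close>

lemma bounded_linear_conj_transpose:
  "bounded_linear (conj_transpose :: complex^'n::finite^'m::finite \<Rightarrow> complex^'m^'n)"
  unfolding linear_conv_bounded_linear[symmetric]
  by (rule linearI) (simp_all add: conj_transpose_def vec_eq_iff)

lemma bounded_bilinear_matrix_mult:
  "bounded_bilinear ((**) :: complex^'n::finite^'m::finite \<Rightarrow> complex^'k::finite^'n \<Rightarrow> complex^'k^'m)"
  unfolding bilinear_conv_bounded_bilinear[symmetric] bilinear_def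
  by (auto intro!: linearI
      simp: matrix_matrix_mult_def vec_eq_iff algebra_simps sum.distrib scaleR_sum_right)

lemma conj_transpose_mult:
  fixes X :: "complex^'n::finite^'m::finite" and Y :: "complex^'k::finite^'n"
  shows "(X ** Y)\<^sup>\<dagger> = Y\<^sup>\<dagger> ** X\<^sup>\<dagger>"
  by (simp add: conj_transpose_def matrix_matrix_mult_def vec_eq_iff mult.commute)

text \<open>Right multiplication mixes columns and leaves the pair index of the rows alone, so a
  factor common to all blocks comes out of the stack.\<close>

lemma col_blocks_mult:
  fixes B :: "'n::finite \<Rightarrow> complex^'c::finite^'r::finite" and V :: "complex^'k::finite^'c"
  shows "col_blocks (\<lambda>\<mu>. B \<mu> ** V) = col_blocks B ** V"
  by (simp add: col_blocks_def matrix_matrix_mult_def vec_eq_iff)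

lemma conj_transpose_col_blocks:
  "(col_blocks B)\<^sup>\<dagger> = row_blocks (\<lambda>\<mu>. (B \<mu>)\<^sup>\<dagger>)"
  by (simp add: col_blocks_def row_blocks_def conj_transpose_def vec_eq_iff)

lemma smooth_imp_differentiable:
  assumes "smooth f" shows "f differentiable (at x)"
proof -
  have "C_k (Suc 0) f"
    using assms by (simp add: smooth_def)
  then show ?thesis
    by simp
qed

text \<open>\<open>vector_derivative\<close> is a choice operator, so \<open>pdiff\<close> is
  meaningful only where the derivative along the coordinate line exists; the chain rule with the
  affine line supplies it.\<close>

lemma has_vector_derivative_pdiff:
  assumes "f differentiable (at x)"
  shows "((\<lambda>t. f (x + t *\<^sub>R axis \<mu> 1)) has_vector_derivative pdiff \<mu> f x) (at 0)"
proof -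
  have line: "(\<lambda>t::real. x + t *\<^sub>R axis \<mu> 1) differentiable (at 0)"
    by (intro derivative_intros)
  have "(f \<circ> (\<lambda>t::real. x + t *\<^sub>R axis \<mu> 1)) differentiable (at 0)"
    using line assms by (intro differentiable_chain_at) auto
  then show ?thesis
    unfolding pdiff_def by (simp add: o_def vector_derivative_works)
qed

lemma pdiff_conj_transpose:
  fixes f :: "real^'n::finite \<Rightarrow> complex^'c::finite^'r::finite"
  assumes "f differentiable (at x)"
  shows "pdiff \<mu> (\<lambda>y. (f y)\<^sup>\<dagger>) x = (pdiff \<mu> f x)\<^sup>\<dagger>"
  unfolding pdiff_def[of _ "\<lambda>y. (f y)\<^sup>\<dagger>"]
  by (rule vector_derivative_at[OF bounded_linear.has_vector_derivative[OF
      bounded_linear_conj_transpose has_vector_derivative_pdiff[OF assms]]])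

lemma pdiff_matrix_mult:
  fixes f :: "real^'n::finite \<Rightarrow> complex^'c::finite^'r::finite"
    and g :: "real^'n \<Rightarrow> complex^'k::finite^'c"
  assumes "f differentiable (at x)" "g differentiable (at x)"
  shows "pdiff \<mu> (\<lambda>y. f y ** g y) x = f x ** pdiff \<mu> g x + pdiff \<mu> f x ** g x"
  using bounded_bilinear.has_vector_derivative[OF bounded_bilinear_matrix_mult
      has_vector_derivative_pdiff[OF assms(1)] has_vector_derivative_pdiff[OF assms(2)]]
  unfolding pdiff_def[of _ "\<lambda>y. f y ** g y"] by (simp add: vector_derivative_at)

lemma differentiable_matrix_mult:
  fixes f :: "real^'n::finite \<Rightarrow> complex^'c::finite^'r::finite"
    and g :: "real^'n \<Rightarrow> complex^'k::finite^'c"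
  assumes "f differentiable (at x)" "g differentiable (at x)"
  shows "(\<lambda>y. f y ** g y) differentiable (at x)"
proof -
  obtain f' g' where "(f has_derivative f') (at x)" "(g has_derivative g') (at x)"
    using assms unfolding differentiable_def by blast
  from bounded_bilinear.FDERIV[OF bounded_bilinear_matrix_mult this]
  show ?thesis
    by (rule differentiableI)
qed

lemma covariant_derivative_gauge:
  fixes \<Psi> :: "real^'n::finite \<Rightarrow> complex^'c::finite^'r::finite"
  assumes "\<Psi> differentiable (at x)" "U differentiable (at x)" "invertible (U x)"
  shows "pdiff \<mu> (\<lambda>y. \<Psi> y ** U y) x + (\<Psi> x ** U x) ** (A \<triangleleft> U) \<mu> x =
    (pdiff \<mu> \<Psi> x + \<Psi> x ** A \<mu> x) ** U x"
proof -
  \<comment> \<open>\<open>matrix_inv\<close> is given by choice, so its inverse property comes from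
    the existence statement in \<open>invertible\<close>.\<close>
  have cancel: "U x ** (matrix_inv (U x) ** Z) = Z" for Z :: "complex^'c^'c"
    using someI_ex[OF assms(3)[unfolded invertible_def]]
    by (simp add: matrix_mul_assoc matrix_inv_def)
  \<comment> \<open>Reassociating to the right puts \<open>U x\<close> and
    \<open>matrix_inv (U x)\<close> at the head of each product, where \<open>cancel\<close>
    applies.\<close>
  have "U x ** (A \<triangleleft> U) \<mu> x = A \<mu> x ** U x - pdiff \<mu> U x"
    unfolding gauge_potential_def
    by (simp add: bounded_bilinear.diff_right[OF bounded_bilinear_matrix_mult] cancel
        flip: matrix_mul_assoc)
  then have "(\<Psi> x ** U x) ** (A \<triangleleft> U) \<mu> x = \<Psi> x ** (A \<mu> x ** U x) - \<Psi> x ** pdiff \<mu> U x"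
    by (simp add: bounded_bilinear.diff_right[OF bounded_bilinear_matrix_mult]
        flip: matrix_mul_assoc)
  then show ?thesis
    by (simp add: pdiff_matrix_mult[OF assms(1,2)] matrix_mul_assoc
        bounded_bilinear.add_left[OF bounded_bilinear_matrix_mult])
qed

text \<open>Brings the density into the shape of the right-hand side of the invariance hypothesis:
  blockwise, the adjoint of \<open>\<Psi> x ** A \<mu> x\<close> is the reversed product of
  adjoints, and the adjoint of the derivative is the derivative of the adjoint.\<close>

lemma gauge_extended_eq:
  fixes \<Psi> :: "real^'n::finite \<Rightarrow> complex^'c::finite^'r::finite"
  assumes "\<Psi> differentiable (at x)"
  shows "gauge_extended L \<Psi> A x =
    (let R = col_blocks (\<lambda>\<mu>. pdiff \<mu> \<Psi> x + \<Psi> x ** A \<mu> x)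
     in L (\<Psi> x, (\<Psi> x)\<^sup>\<dagger>, R, R\<^sup>\<dagger>, x))"
  unfolding gauge_extended_def Let_def
  by (simp add: pdiff_conj_transpose[OF assms] conj_transpose_col_blocks conj_transpose_mult
      linear_add[OF bounded_linear.linear[OF bounded_linear_conj_transpose]])

theorem theorem5p1:
  fixes L :: "(complex^'c::finite^'r::finite) \<times> (complex^'r^'c) \<times> (complex^'c^('n::finite \<times> 'r)) \<times>
      (complex^('n \<times> 'r)^'c) \<times> (real^'n) \<Rightarrow> complex"
    and G \<gg> :: "(complex^'c^'c) set"
    and \<Psi> :: "real^'n \<Rightarrow> complex^'c^'r"
    and A :: "'n \<Rightarrow> real^'n \<Rightarrow> complex^'c^'c"
    and U :: "real^'n \<Rightarrow> complex^'c^'c"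
    and x :: "real^'n"
  assumes "matrix_lie_group G" and "\<gg> = lie_algebra G"
    and "proto_lagrangian L"
    and invariant: "\<And>V P R y. V \<in> G \<Longrightarrow>
      L (P ** V, V\<^sup>\<dagger> ** P\<^sup>\<dagger>, R ** V, V\<^sup>\<dagger> ** R\<^sup>\<dagger>, y) = L (P, P\<^sup>\<dagger>, R, R\<^sup>\<dagger>, y)"
    and "smooth \<Psi>"
    and "\<And>\<mu>. smooth (A \<mu>)" and "\<And>\<mu> y. A \<mu> y \<in> \<gg>"
    and "smooth U" and "\<And>y. U y \<in> G"
  shows "gauge_extended L \<Psi> A x = gauge_extended L (gauge_field \<Psi> U) (A \<triangleleft> U) x \<and>
    gauge_extended L (gauge_field \<Psi> U) (A \<triangleleft> U) x =
      L (\<Psi> x ** U x,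
         (U x)\<^sup>\<dagger> ** (\<Psi> x)\<^sup>\<dagger>,
         col_blocks (\<lambda>\<mu>. pdiff \<mu> (\<lambda>y. \<Psi> y ** U y) x + (\<Psi> x ** U x) ** (A \<triangleleft> U) \<mu> x),
         row_blocks (\<lambda>\<mu>. pdiff \<mu> (\<lambda>y. (\<Psi> y ** U y)\<^sup>\<dagger>) x + ((A \<triangleleft> U) \<mu> x)\<^sup>\<dagger> ** (\<Psi> x ** U x)\<^sup>\<dagger>),
         x)"
proof
  let ?R = "col_blocks (\<lambda>\<mu>. pdiff \<mu> \<Psi> x + \<Psi> x ** A \<mu> x)"
  have diff: "\<Psi> differentiable (at x)" "U differentiable (at x)"
    using assms by (auto intro: smooth_imp_differentiable)
  have inv: "invertible (U x)"
    using assms unfolding matrix_lie_group_def by blast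
  have "gauge_extended L (gauge_field \<Psi> U) (A \<triangleleft> U) x =
      L (\<Psi> x ** U x, (\<Psi> x ** U x)\<^sup>\<dagger>, ?R ** U x, (?R ** U x)\<^sup>\<dagger>, x)"
    using gauge_extended_eq[OF differentiable_matrix_mult[OF diff]]
    by (simp add: gauge_field_def[abs_def] covariant_derivative_gauge[OF diff inv]
        col_blocks_mult Let_def)
  \<comment> \<open>Invariance with \<open>V = U x\<close>, \<open>P = \<Psi> x\<close> and
    \<open>R = ?R\<close>, once the adjoints of products are split into reversed products.\<close>
  also have "\<dots> = L (\<Psi> x, (\<Psi> x)\<^sup>\<dagger>, ?R, ?R\<^sup>\<dagger>, x)"
    using invariant[OF assms(9)] by (simp add: conj_transpose_mult)
  also have "\<dots> = gauge_extended L \<Psi> A x"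
    by (simp add: gauge_extended_eq[OF diff(1)] Let_def)
  finally show "gauge_extended L \<Psi> A x = gauge_extended L (gauge_field \<Psi> U) (A \<triangleleft> U) x" ..
\<comment> \<open>In the second conjunct both sides coincide after every adjoint of a product is
  expanded in the same way.\<close>
qed (simp only: gauge_extended_def gauge_field_def[abs_def] conj_transpose_mult)

end
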